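(* Let $X$ and $Y$ be infinite dimensional complex Banach spaces, and suppose that $S\in L(X)$ and $T\in L(Y)$ satisfy property $(z)$ and are a-isoloid. Then $S\oplus T\in L(X\oplus Y)$ satisfies property $(z)$ if and only if $\sigma_{uw}(S\oplus T)=\sigma_{uw}(S)\cup\sigma_{uw}(T)$.
   Context: $L(X)$ is the algebra of bounded linear operators on $X$. For a bounded operator $T$: $R(T)$ is the range, $\alpha(T)=\dim\ker T$, $\beta(T)=\operatorname{codim} R(T)$; $\sigma(T)$ is the spectrum and $\sigma_a(T)$ the approximate point spectrum; $\mathrm{iso}\,A$ is the set of isolated points of $A\subset\mathbb{C}$. $T$ is upper semi-Fredholm if $R(T)$ is closed and $\alpha(T)<\infty$, with index $\operatorname{ind}T=\alpha(T)-\beta(T)$; it is upper semi-Weyl if moreover $\operatorname{ind}T\le 0$. $\sigma_{uw}(T)$ is the set of $\lambda\in\mathbb{C}$ such that $T-\lambda I$ is not upper semi-Weyl. $\sigma_p^0(T)$ is the set of eigenvalues of $T$ of finite multiplicity ($0<\alpha(T-\lambda I)<\infty$), and $\pi_{00}^a(T)=\mathrm{iso}\,\sigma_a(T)\cap\sigma_p^0(T)$. $T$ satisfies property $(z)$ if $\sigma(T)\setminus\sigma_{uw}(T)=\pi_{00}^a(T)$. $T$ is a-isoloid if every isolated point of $\sigma_a(T)$ is an eigenvalue of $T$. *)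

theory Defs
  imports "HOL-Analysis.Analysis"
begin

section \<open>Complex normed and Banach spaces\<close>

class complex_normed_vector = real_normed_vector +
  fixes scaleC :: "complex \<Rightarrow> 'a \<Rightarrow> 'a" (infixr \<open>*\<^sub>C\<close> 75)
  assumes scaleC_add_right: "a *\<^sub>C (x + y) = a *\<^sub>C x + a *\<^sub>C y"
    and scaleC_add_left: "(a + b) *\<^sub>C x = a *\<^sub>C x + b *\<^sub>C x"
    and scaleC_scaleC: "a *\<^sub>C (b *\<^sub>C x) = (a * b) *\<^sub>C x"
    and scaleC_of_real: "complex_of_real r *\<^sub>C x = r *\<^sub>R x"
    and norm_scaleC: "norm (a *\<^sub>C x) = norm a * norm x"

class cbanach = complex_normed_vector + complete_space

global_interpretation cvs: vector_space "scaleC :: complex \<Rightarrow> 'a \<Rightarrow> 'a::complex_normed_vector"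
proof
  fix x :: 'a
  show "1 *\<^sub>C x = x"
    using scaleC_of_real[of 1 x] by simp
qed (simp_all add: scaleC_add_right scaleC_add_left scaleC_scaleC)

instantiation complex :: cbanach
begin

definition scaleC_complex_def: "a *\<^sub>C (z::complex) = a * z"

instance
  by standard (simp_all add: scaleC_complex_def algebra_simps norm_mult scaleR_conv_of_real)

end

text \<open>
  The direct sum \<open>X \<oplus> Y\<close> is the product type. Its library norm is the Euclidean combination
  of the two norms, which induces the product topology.
\<close>

instantiation prod :: (complex_normed_vector, complex_normed_vector) complex_normed_vector
begin

definition scaleC_prod_def: "a *\<^sub>C x = (a *\<^sub>C fst x, a *\<^sub>C snd x)"

instance
proof
  fix a b :: complex and r :: real and x y :: "'a \<times> 'b"
  show "norm (a *\<^sub>C x) = norm a * norm x"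
    by (simp add: scaleC_prod_def norm_prod_def norm_scaleC power_mult_distrib
        flip: distrib_left)
      (simp add: real_sqrt_mult)
qed (simp_all add: scaleC_prod_def scaleC_add_right scaleC_add_left scaleC_scaleC
    scaleC_of_real scaleR_prod_def)

end

instance prod :: (cbanach, cbanach) cbanach ..


section \<open>Dimension and codimension\<close>

text \<open>
  The library's \<open>dim\<close> is \<open>0\<close> for spaces without a finite basis, hence the values in \<open>enat\<close>.
\<close>

definition cdim :: "'a::complex_normed_vector set \<Rightarrow> enat" where
  "cdim V = (if \<exists>B. finite B \<and> V \<subseteq> cvs.span B then enat (cvs.dim V) else \<infinity>)"

definition complementary :: "'a::complex_normed_vector set \<Rightarrow> 'a set \<Rightarrow> bool" where
  "complementary V W \<longleftrightarrow>
     cvs.subspace W \<and> V \<inter> W = {0} \<and> (\<forall>x. \<exists>v\<in>V. \<exists>w\<in>W. x = v + w)"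

text \<open>
  The codimension of a subspace, i.e. the dimension of the quotient, is the dimension of any
  algebraic complement; \<open>ccodim_eq\<close> and \<open>complementary_exists\<close> below show that this is
  well defined.
\<close>

definition ccodim :: "'a::complex_normed_vector set \<Rightarrow> enat" where
  "ccodim V = (THE d. \<exists>W. complementary V W \<and> cdim W = d)"

lemma cdim_complementary_le:
  fixes V :: "'a::complex_normed_vector set"
  assumes V: "cvs.subspace V" and W: "complementary V W" and W': "complementary V W'"
  shows "cdim W' \<le> cdim W"
proof (cases "\<exists>B. finite B \<and> W \<subseteq> cvs.span B")
  case True
  then obtain C where C: "finite C" "W \<subseteq> cvs.span C" by blast
  obtain B where B: "B \<subseteq> W" "cvs.independent B" "W \<subseteq> cvs.span B" "card B = cvs.dim W"
    using cvs.basis_exists by blast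
  have finB: "finite B"
    using cvs.independent_span_bound[OF C(1) B(2)] B(1) C(2) by blast
  have "\<forall>x. \<exists>w\<in>W'. x - w \<in> V"
    using W' unfolding complementary_def by (metis add_diff_cancel_right')
  then obtain f where f: "\<And>x. f x \<in> W'" "\<And>x. x - f x \<in> V" by metis
  have span_f: "\<exists>s\<in>cvs.span (f ` B). u - s \<in> V" if "u \<in> cvs.span B" for u
    using that
  proof (induction rule: cvs.span_induct_alt)
    case base
    show ?case using cvs.span_zero cvs.subspace_0[OF V] by force
  next
    case (step c b y)
    then obtain s where s: "s \<in> cvs.span (f ` B)" "y - s \<in> V" by blast
    have "c *\<^sub>C b + y - (c *\<^sub>C f b + s) = c *\<^sub>C (b - f b) + (y - s)"
      by (simp add: cvs.scale_right_diff_distrib)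
    also have "\<dots> \<in> V"
      using cvs.subspace_add[OF V cvs.subspace_scale[OF V f(2)] s(2)] .
    finally show ?case
      using cvs.span_add[OF cvs.span_scale[OF cvs.span_base] s(1)] step(1) by blast
  qed
  have fW: "cvs.span (f ` B) \<subseteq> W'"
    using cvs.span_minimal[of "f ` B" W'] f(1) W' unfolding complementary_def by blast
  have sub: "W' \<subseteq> cvs.span (f ` B)"
  proof
    fix w assume w: "w \<in> W'"
    obtain v u where u: "v \<in> V" "u \<in> W" "w = v + u"
      using W unfolding complementary_def by blast
    obtain s where s: "s \<in> cvs.span (f ` B)" "u - s \<in> V"
      using span_f B(3) u(2) by blast
    have "w - s = v + (u - s)" using u by simp
    hence "w - s \<in> V" using cvs.subspace_add[OF V u(1) s(2)] by metis
    moreover have "w - s \<in> W'"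
      using W' w s(1) fW cvs.subspace_diff unfolding complementary_def by blast
    ultimately have "w - s = 0" using W' unfolding complementary_def by blast
    thus "w \<in> cvs.span (f ` B)" using s(1) by simp
  qed
  have "cvs.dim W' \<le> card (f ` B)"
    using cvs.dim_le_card[OF sub] finB by simp
  also have "\<dots> \<le> cvs.dim W"
    using card_image_le[OF finB] B(4) by metis
  finally have "cvs.dim W' \<le> cvs.dim W" .
  moreover have "\<exists>B. finite B \<and> W' \<subseteq> cvs.span B" using sub finB by blast
  ultimately show ?thesis using True by (simp add: cdim_def)
next
  case False
  hence "cdim W = \<infinity>" unfolding cdim_def by (rule if_not_P)
  thus ?thesis by simp
qed

lemma ccodim_eq:
  assumes "cvs.subspace V" and "complementary V W"
  shows "ccodim V = cdim W"
  unfolding ccodim_def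
  using assms by (intro the_equality) (auto intro: antisym cdim_complementary_le)

lemma complementary_exists:
  fixes V :: "'a::complex_normed_vector set"
  assumes V: "cvs.subspace V"
  shows "\<exists>W. complementary V W"
proof -
  obtain B where B: "B \<subseteq> V" "cvs.independent B" "V \<subseteq> cvs.span B"
    using cvs.maximal_independent_subset by blast
  have spanB: "cvs.span B = V"
    using B cvs.span_minimal[OF B(1) V] by blast
  obtain D where D: "B \<subseteq> D" "cvs.independent D" "UNIV \<subseteq> cvs.span D"
    by (rule cvs.maximal_independent_subset_extend[OF subset_UNIV B(2)])
  have un: "cvs.span (B \<union> (D - B)) = UNIV" 
  proof -
    have "B \<union> (D - B) = D" using D(1) by blast
    thus ?thesis using D(3) by (metis top.extremum_uniqueI)
  qed
  have "V \<inter> cvs.span (D - B) = {0}"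
  proof -
    have "x = 0" if "x \<in> cvs.span B" "x \<in> cvs.span (D - B)" for x
    proof -
      have xD: "x \<in> cvs.span D" using D(3) by blast
      have "cvs.representation D x = cvs.representation B x"
        using cvs.representation_extend[OF D(2) that(1) D(1)] .
      moreover have "cvs.representation D x = cvs.representation (D - B) x"
        using cvs.representation_extend[OF D(2) that(2)] by blast
      ultimately have "cvs.representation D x b = 0" for b
        using cvs.representation_ne_zero[of B x b] cvs.representation_ne_zero[of "D - B" x b]
        by auto
      thus "x = 0"
        using cvs.sum_nonzero_representation_eq[OF D(2) xD] by simp
    qed
    thus ?thesis using spanB cvs.span_zero cvs.subspace_0[OF V] by blast
  qed
  moreover have "\<forall>x. \<exists>v\<in>V. \<exists>w\<in>cvs.span (D - B). x = v + w"
    using un unfolding cvs.span_Un spanB by blast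
  ultimately show ?thesis unfolding complementary_def by blast
qed


section \<open>Spectra of bounded operators\<close>

definition bounded_clinear :: "('a::complex_normed_vector \<Rightarrow> 'b::complex_normed_vector) \<Rightarrow> bool" where
  "bounded_clinear T \<longleftrightarrow> bounded_linear T \<and> (\<forall>c x. T (c *\<^sub>C x) = c *\<^sub>C T x)"

definition shift :: "('a::complex_normed_vector \<Rightarrow> 'a) \<Rightarrow> complex \<Rightarrow> 'a \<Rightarrow> 'a" where
  "shift T \<mu> = (\<lambda>x. T x - \<mu> *\<^sub>C x)"

definition kernel :: "('a::complex_normed_vector \<Rightarrow> 'a) \<Rightarrow> 'a set" where
  "kernel T = {x. T x = 0}"

definition nullity :: "('a::complex_normed_vector \<Rightarrow> 'a) \<Rightarrow> enat" where
  "nullity T = cdim (kernel T)"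

definition deficiency :: "('a::complex_normed_vector \<Rightarrow> 'a) \<Rightarrow> enat" where
  "deficiency T = ccodim (range T)"

definition upper_semi_Fredholm :: "('a::complex_normed_vector \<Rightarrow> 'a) \<Rightarrow> bool" where
  "upper_semi_Fredholm T \<longleftrightarrow> closed (range T) \<and> nullity T < \<infinity>"

text \<open>
  Only used for operators of finite nullity; the deficiency may be infinite, and then the
  index is \<open>-\<infinity>\<close>.
\<close>

definition fredholm_index :: "('a::complex_normed_vector \<Rightarrow> 'a) \<Rightarrow> ereal" where
  "fredholm_index T = ereal_of_enat (nullity T) - ereal_of_enat (deficiency T)"

definition upper_semi_Weyl :: "('a::complex_normed_vector \<Rightarrow> 'a) \<Rightarrow> bool" where
  "upper_semi_Weyl T \<longleftrightarrow> upper_semi_Fredholm T \<and> fredholm_index T \<le> 0"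

definition spectrum :: "('a::complex_normed_vector \<Rightarrow> 'a) \<Rightarrow> complex set" where
  "spectrum T =
     {\<mu>. \<not> (\<exists>R. bounded_clinear R \<and> R \<circ> shift T \<mu> = id \<and> shift T \<mu> \<circ> R = id)}"

definition approx_point_spectrum :: "('a::complex_normed_vector \<Rightarrow> 'a) \<Rightarrow> complex set" where
  "approx_point_spectrum T =
     {\<mu>. \<exists>x::nat \<Rightarrow> 'a. (\<forall>n. norm (x n) = 1) \<and> (\<lambda>n. shift T \<mu> (x n)) \<longlonglongrightarrow> 0}"

definition upper_semi_Weyl_spectrum :: "('a::complex_normed_vector \<Rightarrow> 'a) \<Rightarrow> complex set" where
  "upper_semi_Weyl_spectrum T = {\<mu>. \<not> upper_semi_Weyl (shift T \<mu>)}"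

definition eigenvalue :: "('a::complex_normed_vector \<Rightarrow> 'a) \<Rightarrow> complex \<Rightarrow> bool" where
  "eigenvalue T \<mu> \<longleftrightarrow> (\<exists>x. x \<noteq> 0 \<and> T x = \<mu> *\<^sub>C x)"

definition finite_eigenvalues :: "('a::complex_normed_vector \<Rightarrow> 'a) \<Rightarrow> complex set" where
  "finite_eigenvalues T = {\<mu>. 0 < nullity (shift T \<mu>) \<and> nullity (shift T \<mu>) < \<infinity>}"

definition iso :: "complex set \<Rightarrow> complex set" where
  "iso A = {\<mu>. \<mu> isolated_in A}"

definition pi00a :: "('a::complex_normed_vector \<Rightarrow> 'a) \<Rightarrow> complex set" where
  "pi00a T = iso (approx_point_spectrum T) \<inter> finite_eigenvalues T"

definition property_z :: "('a::complex_normed_vector \<Rightarrow> 'a) \<Rightarrow> bool" where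
  "property_z T \<longleftrightarrow> spectrum T - upper_semi_Weyl_spectrum T = pi00a T"

definition a_isoloid :: "('a::complex_normed_vector \<Rightarrow> 'a) \<Rightarrow> bool" where
  "a_isoloid T \<longleftrightarrow> (\<forall>\<mu>\<in>iso (approx_point_spectrum T). eigenvalue T \<mu>)"

text \<open>The direct sum \<open>S \<oplus> T\<close>.\<close>

definition op_sum :: "('a::complex_normed_vector \<Rightarrow> 'a) \<Rightarrow> ('b::complex_normed_vector \<Rightarrow> 'b) \<Rightarrow>
    'a \<times> 'b \<Rightarrow> 'a \<times> 'b" (infixr \<open>\<oplus>\<^sub>o\<^sub>p\<close> 65) where
  "S \<oplus>\<^sub>o\<^sub>p T = (\<lambda>(x, y). (S x, T y))"

lemma bounded_clinear_op_sum:
  assumes "bounded_clinear S" and "bounded_clinear T"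
  shows "bounded_clinear (S \<oplus>\<^sub>o\<^sub>p T)"
  using assms
    bounded_linear_Pair[OF bounded_linear_compose[OF _ bounded_linear_fst, of S]
      bounded_linear_compose[OF _ bounded_linear_snd, of T]]
  by (auto simp: bounded_clinear_def op_sum_def scaleC_prod_def case_prod_unfold)

end

theory Submission
  imports Defs
begin

text \<open>
  For every bounded operator the upper semi-Weyl spectrum lies in the approximate point spectrum,
  because an operator that is bounded below is injective with closed range. Two consequences
  carry the proof.

  First, property \<open>(z)\<close> forces the spectrum to equal the approximate point spectrum: a point of
  the spectrum outside the approximate point spectrum would lie outside the upper semi-Weyl
  spectrum, hence in \<open>\<pi>\<^sub>0\<^sub>0\<^sup>a\<close>, which is part of the approximate point spectrum
  (\<open>property_z_spectrum_eq\<close>).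

  Second, the hypotheses on \<open>S\<close> and \<open>T\<close> alone already determine \<open>\<pi>\<^sub>0\<^sub>0\<^sup>a(S \<oplus> T)\<close>: it is the
  spectrum of \<open>S \<oplus> T\<close> with both upper semi-Weyl spectra removed (\<open>pi00a_op_sum\<close>). Indeed the
  spectra, the approximate point spectra and the kernels all split over the direct sum, and since
  approximate point spectra are closed, a point is isolated in their union exactly if it belongs
  to one of them and is isolated in each one to which it belongs. Being a-isoloid turns such an
  isolated point into an eigenvalue of that summand, so that finite multiplicity for \<open>S \<oplus> T\<close>
  gives membership in \<open>\<pi>\<^sub>0\<^sub>0\<^sup>a\<close> of the summand.

  Property \<open>(z)\<close> for \<open>S \<oplus> T\<close> thus says that \<open>\<sigma>\<^sub>u\<^sub>w(S \<oplus> T)\<close> and \<open>\<sigma>\<^sub>u\<^sub>w(S) \<union> \<sigma>\<^sub>u\<^sub>w(T)\<close> have the same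
  complement in \<open>\<sigma>(S \<oplus> T)\<close>. Both sets are contained in \<open>\<sigma>(S \<oplus> T)\<close>, so they have the same
  complement exactly if they are equal.
\<close>

section \<open>Spectra of a single operator\<close>

lemma bounded_linear_shift:
  assumes "bounded_clinear T"
  shows "bounded_linear (shift T \<mu>)"
proof -
  have "bounded_linear (\<lambda>x::'a. \<mu> *\<^sub>C x)"
  proof (rule bounded_linear_intro)
    fix x y :: 'a and r :: real
    show "\<mu> *\<^sub>C (x + y) = \<mu> *\<^sub>C x + \<mu> *\<^sub>C y"
      by (rule scaleC_add_right)
    show "\<mu> *\<^sub>C (r *\<^sub>R x) = r *\<^sub>R (\<mu> *\<^sub>C x)"
      by (simp add: scaleC_scaleC mult.commute flip: scaleC_of_real)
    show "norm (\<mu> *\<^sub>C x) \<le> norm x * norm \<mu>"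
      by (simp add: norm_scaleC)
  qed
  thus ?thesis
    using assms unfolding shift_def bounded_clinear_def by (blast intro: bounded_linear_sub)
qed

text \<open>
  All facts about approximate point spectra below go through this description: a sequence of unit
  vectors witnesses the failure of a lower bound, after normalisation of the vectors that violate
  the bounds \<open>1 / n\<close>.
\<close>

lemma approx_point_spectrum_iff_not_bounded_below:
  fixes T :: "'a::complex_normed_vector \<Rightarrow> 'a"
  assumes T: "bounded_clinear T"
  shows "\<mu> \<in> approx_point_spectrum T \<longleftrightarrow> \<not> (\<exists>c>0. \<forall>x. c * norm x \<le> norm (shift T \<mu> x))"
proof
  assume "\<mu> \<in> approx_point_spectrum T"
  then obtain x where x: "\<And>n. norm (x n) = 1" "(\<lambda>n. shift T \<mu> (x n)) \<longlonglongrightarrow> 0"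
    unfolding approx_point_spectrum_def by blast
  have "c \<le> 0" if "\<forall>x. c * norm x \<le> norm (shift T \<mu> x)" for c
  proof (rule LIMSEQ_le_const)
    show "(\<lambda>n. norm (shift T \<mu> (x n))) \<longlonglongrightarrow> 0"
      using tendsto_norm[OF x(2)] by simp
    have "c \<le> norm (shift T \<mu> (x n))" for n
      using spec[OF that, of "x n"] x(1) by simp
    thus "\<exists>N. \<forall>n\<ge>N. c \<le> norm (shift T \<mu> (x n))"
      by blast
  qed
  thus "\<not> (\<exists>c>0. \<forall>x. c * norm x \<le> norm (shift T \<mu> x))"
    by force
next
  interpret L: bounded_linear "shift T \<mu>"
    by (rule bounded_linear_shift[OF T])
  assume nb: "\<not> (\<exists>c>0. \<forall>x. c * norm x \<le> norm (shift T \<mu> x))"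
  have "\<exists>x. norm (shift T \<mu> x) < inverse (real (Suc n)) * norm x" for n
    using nb by (metis not_le inverse_positive_iff_positive of_nat_0_less_iff zero_less_Suc)
  then obtain x where x: "\<And>n. norm (shift T \<mu> (x n)) < inverse (real (Suc n)) * norm (x n)"
    by metis
  have nz: "norm (x n) > 0" for n
    using x[of n] by (cases "x n = 0") (auto simp: L.zero)
  define u where "u n = x n /\<^sub>R norm (x n)" for n
  have "norm (u n) = 1" for n
    using nz[of n] by (simp add: u_def)
  moreover have "(\<lambda>n. shift T \<mu> (u n)) \<longlonglongrightarrow> 0"
  proof (rule Lim_null_comparison)
    have "norm (shift T \<mu> (u n)) \<le> inverse (real (Suc n))" for n
      using nz[of n] x[of n] by (simp add: u_def L.scaleR field_simps)
    thus "\<forall>\<^sub>F n in sequentially. norm (shift T \<mu> (u n)) \<le> inverse (real (Suc n))"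
      by simp
  qed (rule LIMSEQ_inverse_real_of_nat)
  ultimately show "\<mu> \<in> approx_point_spectrum T"
    unfolding approx_point_spectrum_def by blast
qed

text \<open>A lower bound \<open>c\<close> at \<open>\<mu>\<close> leaves the lower bound \<open>c / 2\<close> at every \<open>\<nu>\<close> within \<open>c / 2\<close> of \<open>\<mu>\<close>.\<close>

lemma closed_approx_point_spectrum:
  fixes T :: "'a::complex_normed_vector \<Rightarrow> 'a"
  assumes T: "bounded_clinear T"
  shows "closed (approx_point_spectrum T)"
  unfolding closed_def open_dist
proof
  fix \<mu> assume "\<mu> \<in> - approx_point_spectrum T"
  then obtain c where c: "c > 0" "\<And>x. c * norm x \<le> norm (shift T \<mu> x)"
    using approx_point_spectrum_iff_not_bounded_below[OF T] by auto
  have "\<nu> \<in> - approx_point_spectrum T" if \<nu>: "dist \<nu> \<mu> < c / 2" for \<nu>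
  proof -
    have "c / 2 * norm x \<le> norm (shift T \<nu> x)" for x
    proof -
      have "shift T \<mu> x = shift T \<nu> x + (\<nu> - \<mu>) *\<^sub>C x"
        by (simp add: shift_def cvs.scale_left_diff_distrib)
      hence "norm (shift T \<mu> x) \<le> norm (shift T \<nu> x) + dist \<nu> \<mu> * norm x"
        by (metis norm_triangle_ineq norm_scaleC dist_norm)
      moreover have "dist \<nu> \<mu> * norm x \<le> c / 2 * norm x"
        using \<nu> by (intro mult_right_mono) auto
      ultimately show ?thesis
        using c(2)[of x] by simp
    qed
    thus ?thesis
      using approx_point_spectrum_iff_not_bounded_below[OF T] c(1) half_gt_zero by blast
  qed
  thus "\<exists>e>0. \<forall>\<nu>. dist \<nu> \<mu> < e \<longrightarrow> \<nu> \<in> - approx_point_spectrum T"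
    using c(1) half_gt_zero by blast
qed

text \<open>A bounded inverse provides the lower bound.\<close>

lemma approx_point_spectrum_subset_spectrum:
  fixes T :: "'a::complex_normed_vector \<Rightarrow> 'a"
  assumes T: "bounded_clinear T"
  shows "approx_point_spectrum T \<subseteq> spectrum T"
proof
  fix \<mu> assume \<mu>: "\<mu> \<in> approx_point_spectrum T"
  show "\<mu> \<in> spectrum T"
  proof (rule ccontr)
    assume "\<mu> \<notin> spectrum T"
    then obtain R where R: "bounded_linear R" "R \<circ> shift T \<mu> = id"
      unfolding spectrum_def bounded_clinear_def by blast
    obtain K where K: "K > 0" "\<And>x. norm (R x) \<le> norm x * K"
      using bounded_linear.pos_bounded[OF R(1)] by blast
    have "inverse K * norm x \<le> norm (shift T \<mu> x)" for x
      using K(2)[of "shift T \<mu> x"] K(1) fun_cong[OF R(2), of x] by (simp add: field_simps)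
    thus False
      using \<mu> approx_point_spectrum_iff_not_bounded_below[OF T] K(1)
        positive_imp_inverse_positive by blast
  qed
qed

text \<open>
  An operator that is bounded below is injective, and its range is complete, hence closed; with
  nullity zero the index cannot be positive.
\<close>

lemma upper_semi_Weyl_spectrum_subset_approx_point_spectrum:
  fixes T :: "'a::cbanach \<Rightarrow> 'a"
  assumes T: "bounded_clinear T"
  shows "upper_semi_Weyl_spectrum T \<subseteq> approx_point_spectrum T"
proof
  fix \<mu> assume \<mu>: "\<mu> \<in> upper_semi_Weyl_spectrum T"
  show "\<mu> \<in> approx_point_spectrum T"
  proof (rule ccontr)
    assume "\<mu> \<notin> approx_point_spectrum T"
    then obtain c where c: "c > 0" "\<And>x. c * norm x \<le> norm (shift T \<mu> x)"
      using approx_point_spectrum_iff_not_bounded_below[OF T] by auto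
    interpret L: bounded_linear "shift T \<mu>"
      by (rule bounded_linear_shift[OF T])
    have "complete (range (shift T \<mu>))"
      using c by (intro complete_isometric_image[of c] L.bounded_linear_axioms)
        (auto simp: complete_UNIV)
    hence cl: "closed (range (shift T \<mu>))"
      by (rule complete_imp_closed)
    have "x = 0" if "shift T \<mu> x = 0" for x
      using c(2)[of x] c(1) that by (simp add: mult_le_0_iff)
    hence ker: "kernel (shift T \<mu>) = {0}"
      by (auto simp: kernel_def L.zero)
    have "{0::'a} \<subseteq> cvs.span {}"
      by simp
    hence null: "nullity (shift T \<mu>) = 0"
      unfolding nullity_def ker cdim_def using cvs.dim_le_card[of "{0::'a}" "{}"]
      by (auto simp: zero_enat_def)
    have "upper_semi_Weyl (shift T \<mu>)"
      using cl null unfolding upper_semi_Weyl_def upper_semi_Fredholm_def fredholm_index_def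
      by (simp add: ereal_of_enat_nonneg)
    thus False
      using \<mu> unfolding upper_semi_Weyl_spectrum_def by blast
  qed
qed

lemma property_z_spectrum_eq:
  fixes T :: "'a::cbanach \<Rightarrow> 'a"
  assumes "bounded_clinear T" and "property_z T"
  shows "spectrum T = approx_point_spectrum T"
proof -
  have "pi00a T \<subseteq> approx_point_spectrum T"
    by (auto simp: pi00a_def iso_def isolated_in_def)
  thus ?thesis
    using approx_point_spectrum_subset_spectrum[OF assms(1)]
      upper_semi_Weyl_spectrum_subset_approx_point_spectrum[OF assms(1)] assms(2)
    unfolding property_z_def by blast
qed

section \<open>Spectra of a direct sum\<close>

lemma shift_op_sum: "shift (S \<oplus>\<^sub>o\<^sub>p T) \<mu> (x, y) = (shift S \<mu> x, shift T \<mu> y)"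
  by (simp add: shift_def op_sum_def scaleC_prod_def)

text \<open>
  The compression of a bounded inverse of \<open>S \<oplus> T - \<mu>\<close> to each summand inverts that summand,
  because an operator that leaves both summands invariant has an inverse that does so as well.
\<close>

lemma spectrum_op_sum:
  fixes S :: "'a::complex_normed_vector \<Rightarrow> 'a" and T :: "'b::complex_normed_vector \<Rightarrow> 'b"
  assumes S: "bounded_clinear S" and T: "bounded_clinear T"
  shows "spectrum (S \<oplus>\<^sub>o\<^sub>p T) = spectrum S \<union> spectrum T"
proof -
  have "\<mu> \<notin> spectrum (S \<oplus>\<^sub>o\<^sub>p T) \<longleftrightarrow> \<mu> \<notin> spectrum S \<and> \<mu> \<notin> spectrum T" for \<mu>
  proof
    assume "\<mu> \<notin> spectrum (S \<oplus>\<^sub>o\<^sub>p T)"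
    then obtain R where R: "bounded_clinear R" "R \<circ> shift (S \<oplus>\<^sub>o\<^sub>p T) \<mu> = id"
        "shift (S \<oplus>\<^sub>o\<^sub>p T) \<mu> \<circ> R = id"
      unfolding spectrum_def by blast
    interpret R: bounded_linear R
      using R(1) unfolding bounded_clinear_def by blast
    interpret LS: bounded_linear "shift S \<mu>"
      by (rule bounded_linear_shift[OF S])
    interpret LT: bounded_linear "shift T \<mu>"
      by (rule bounded_linear_shift[OF T])
    have RL: "R (shift S \<mu> x, shift T \<mu> y) = (x, y)" for x y
      using fun_cong[OF R(2), of "(x, y)"] by (simp add: shift_op_sum)
    have LR: "shift S \<mu> (fst (R p)) = fst p" "shift T \<mu> (snd (R p)) = snd p" for p
      using fun_cong[OF R(3), of p] shift_op_sum[of S T \<mu> "fst (R p)" "snd (R p)"]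
      by (auto simp: prod_eq_iff)
    have RC: "R (c *\<^sub>C x) = c *\<^sub>C R x" for c x
      using R(1) unfolding bounded_clinear_def by blast
    define A where "A x = fst (R (x, 0))" for x
    define B where "B y = snd (R (0, y))" for y
    have "bounded_linear A" "bounded_linear B"
      unfolding A_def B_def
      by (intro bounded_linear_compose[OF bounded_linear_fst]
          bounded_linear_compose[OF bounded_linear_snd]
          bounded_linear_compose[OF R.bounded_linear_axioms]
          bounded_linear_Pair bounded_linear_ident bounded_linear_zero)+
    moreover have "A (c *\<^sub>C x) = c *\<^sub>C A x" "B (c *\<^sub>C y) = c *\<^sub>C B y" for c x y
      using RC[of c "(x, 0)"] RC[of c "(0, y)"] by (simp_all add: A_def B_def scaleC_prod_def)
    ultimately have AB: "bounded_clinear A" "bounded_clinear B"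
      unfolding bounded_clinear_def by blast+
    have "A (shift S \<mu> x) = x" "B (shift T \<mu> y) = y" for x y
      using RL[of x 0] RL[of 0 y] by (simp_all add: A_def B_def LS.zero LT.zero)
    moreover have "shift S \<mu> (A x) = x" "shift T \<mu> (B y) = y" for x y
      using LR(1)[of "(x, 0)"] LR(2)[of "(0, y)"] by (simp_all add: A_def B_def)
    ultimately show "\<mu> \<notin> spectrum S \<and> \<mu> \<notin> spectrum T"
      using AB unfolding spectrum_def by (auto simp: fun_eq_iff)
  next
    assume "\<mu> \<notin> spectrum S \<and> \<mu> \<notin> spectrum T"
    then obtain A B where AB: "bounded_clinear A" "bounded_clinear B"
        "A \<circ> shift S \<mu> = id" "shift S \<mu> \<circ> A = id" "B \<circ> shift T \<mu> = id" "shift T \<mu> \<circ> B = id"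
      unfolding spectrum_def by blast
    have "bounded_clinear (A \<oplus>\<^sub>o\<^sub>p B)"
      using AB(1,2) by (rule bounded_clinear_op_sum)
    moreover have "(A \<oplus>\<^sub>o\<^sub>p B) \<circ> shift (S \<oplus>\<^sub>o\<^sub>p T) \<mu> = id" "shift (S \<oplus>\<^sub>o\<^sub>p T) \<mu> \<circ> (A \<oplus>\<^sub>o\<^sub>p B) = id"
      using AB(3-6) by (auto simp: fun_eq_iff shift_op_sum op_sum_def[of A B])
    ultimately show "\<mu> \<notin> spectrum (S \<oplus>\<^sub>o\<^sub>p T)"
      unfolding spectrum_def by blast
  qed
  thus ?thesis
    by blast
qed

lemma approx_point_spectrum_op_sum:
  fixes S :: "'a::complex_normed_vector \<Rightarrow> 'a" and T :: "'b::complex_normed_vector \<Rightarrow> 'b"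
  assumes S: "bounded_clinear S" and T: "bounded_clinear T"
  shows "approx_point_spectrum (S \<oplus>\<^sub>o\<^sub>p T) = approx_point_spectrum S \<union> approx_point_spectrum T"
proof -
  have "(\<exists>c>0. \<forall>p. c * norm p \<le> norm (shift (S \<oplus>\<^sub>o\<^sub>p T) \<mu> p)) \<longleftrightarrow>
      (\<exists>c>0. \<forall>x. c * norm x \<le> norm (shift S \<mu> x)) \<and> (\<exists>c>0. \<forall>y. c * norm y \<le> norm (shift T \<mu> y))"
    for \<mu>
  proof
    interpret LS: bounded_linear "shift S \<mu>"
      by (rule bounded_linear_shift[OF S])
    interpret LT: bounded_linear "shift T \<mu>"
      by (rule bounded_linear_shift[OF T])
    assume "\<exists>c>0. \<forall>p. c * norm p \<le> norm (shift (S \<oplus>\<^sub>o\<^sub>p T) \<mu> p)"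
    then obtain c where c: "c > 0" "\<And>p. c * norm p \<le> norm (shift (S \<oplus>\<^sub>o\<^sub>p T) \<mu> p)"
      by blast
    have "c * norm x \<le> norm (shift S \<mu> x)" "c * norm y \<le> norm (shift T \<mu> y)" for x y
      using c(2)[of "(x, 0)"] c(2)[of "(0, y)"]
      by (simp_all add: shift_op_sum LS.zero LT.zero norm_Pair)
    thus "(\<exists>c>0. \<forall>x. c * norm x \<le> norm (shift S \<mu> x)) \<and>
        (\<exists>c>0. \<forall>y. c * norm y \<le> norm (shift T \<mu> y))"
      using c(1) by blast
  next
    assume "(\<exists>c>0. \<forall>x. c * norm x \<le> norm (shift S \<mu> x)) \<and>
        (\<exists>c>0. \<forall>y. c * norm y \<le> norm (shift T \<mu> y))"
    then obtain a b where ab: "a > 0" "b > 0" "\<And>x. a * norm x \<le> norm (shift S \<mu> x)"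
        "\<And>y. b * norm y \<le> norm (shift T \<mu> y)"
      by blast
    define c where "c = min a b"
    have c: "c > 0" "c \<le> a" "c \<le> b"
      using ab(1,2) by (auto simp: c_def)
    have "c * norm p \<le> norm (shift (S \<oplus>\<^sub>o\<^sub>p T) \<mu> p)" for p
    proof (cases p)
      case (Pair x y)
      have xy: "c * norm x \<le> norm (shift S \<mu> x)" "c * norm y \<le> norm (shift T \<mu> y)"
        using ab(3)[of x] ab(4)[of y] c mult_right_mono[of c a "norm x"]
          mult_right_mono[of c b "norm y"] by auto
      have "c * norm p = sqrt ((c * norm x)\<^sup>2 + (c * norm y)\<^sup>2)"
        using c(1) by (simp add: Pair norm_Pair power_mult_distrib real_sqrt_mult
            flip: distrib_left)
      also have "\<dots> \<le> sqrt ((norm (shift S \<mu> x))\<^sup>2 + (norm (shift T \<mu> y))\<^sup>2)"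
        using xy c(1) by (intro real_sqrt_le_mono add_mono power_mono) auto
      also have "\<dots> = norm (shift (S \<oplus>\<^sub>o\<^sub>p T) \<mu> p)"
        by (simp add: Pair shift_op_sum norm_Pair)
      finally show ?thesis .
    qed
    thus "\<exists>c>0. \<forall>p. c * norm p \<le> norm (shift (S \<oplus>\<^sub>o\<^sub>p T) \<mu> p)"
      using c(1) by blast
  qed
  thus ?thesis
    by (simp only: set_eq_iff Un_iff approx_point_spectrum_iff_not_bounded_below[OF S]
        approx_point_spectrum_iff_not_bounded_below[OF T]
        approx_point_spectrum_iff_not_bounded_below[OF bounded_clinear_op_sum[OF S T]]) simp
qed

section \<open>Eigenvalues of finite multiplicity of a direct sum\<close>

lemma cdim_finite_iff: "cdim V < \<infinity> \<longleftrightarrow> (\<exists>B. finite B \<and> V \<subseteq> cvs.span B)"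
  by (simp add: cdim_def)

lemma cdim_pos_iff: "0 < cdim V \<longleftrightarrow> (\<exists>x\<in>V. x \<noteq> 0)"
proof (cases "\<exists>C. finite C \<and> V \<subseteq> cvs.span C")
  case True
  then obtain C where C: "finite C" "V \<subseteq> cvs.span C"
    by blast
  obtain B where B: "B \<subseteq> V" "cvs.independent B" "V \<subseteq> cvs.span B" "card B = cvs.dim V"
    using cvs.basis_exists by blast
  have "cvs.dim V = 0 \<longleftrightarrow> V \<subseteq> {0}"
  proof
    assume "cvs.dim V = 0"
    moreover have "finite B"
      using cvs.independent_span_bound[OF C(1) B(2)] B(1) C(2) by blast
    ultimately show "V \<subseteq> {0}"
      using B(3,4) by simp
  next
    assume "V \<subseteq> {0}"
    thus "cvs.dim V = 0"
      using cvs.dim_le_card[of V "{}"] by simp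
  qed
  moreover have "cdim V = enat (cvs.dim V)"
    using True by (simp add: cdim_def)
  ultimately show ?thesis
    by (auto simp: zero_enat_def)
next
  case False
  hence "cdim V = \<infinity>"
    unfolding cdim_def by (rule if_not_P)
  moreover have "\<not> V \<subseteq> cvs.span {}"
    using False by blast
  ultimately show ?thesis
    by auto
qed

lemma cdim_linear_image_finite:
  fixes f :: "'a::complex_normed_vector \<Rightarrow> 'b::complex_normed_vector"
  assumes "\<And>x y. f (x + y) = f x + f y" and "\<And>c x. f (c *\<^sub>C x) = c *\<^sub>C f x" and "cdim V < \<infinity>"
  shows "cdim (f ` V) < \<infinity>"
proof -
  interpret module_hom "scaleC :: complex \<Rightarrow> 'a \<Rightarrow> 'a" "scaleC :: complex \<Rightarrow> 'b \<Rightarrow> 'b" f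
    by unfold_locales (fact assms)+
  show ?thesis
    using assms(3) unfolding cdim_finite_iff by (metis finite_imageI image_mono span_image)
qed

lemma cdim_Times_finite_iff:
  fixes V :: "'a::complex_normed_vector set" and W :: "'b::complex_normed_vector set"
  assumes "0 \<in> V" and "0 \<in> W"
  shows "cdim (V \<times> W) < \<infinity> \<longleftrightarrow> cdim V < \<infinity> \<and> cdim W < \<infinity>"
proof
  assume "cdim (V \<times> W) < \<infinity>"
  hence "cdim (fst ` (V \<times> W)) < \<infinity>" "cdim (snd ` (V \<times> W)) < \<infinity>"
    by (intro cdim_linear_image_finite; simp add: scaleC_prod_def)+
  thus "cdim V < \<infinity> \<and> cdim W < \<infinity>"
    using assms by (auto split: if_splits)
next
  assume "cdim V < \<infinity> \<and> cdim W < \<infinity>"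
  hence "cdim ((\<lambda>x. (x, 0::'b)) ` V) < \<infinity>" "cdim ((\<lambda>y. (0::'a, y)) ` W) < \<infinity>"
    by (intro cdim_linear_image_finite; simp add: scaleC_prod_def)+
  then obtain B C where BC: "finite B" "(\<lambda>x. (x, 0::'b)) ` V \<subseteq> cvs.span B"
      "finite C" "(\<lambda>y. (0::'a, y)) ` W \<subseteq> cvs.span C"
    unfolding cdim_finite_iff by blast
  have "V \<times> W \<subseteq> cvs.span (B \<union> C)"
  proof clarify
    fix x y assume "x \<in> V" "y \<in> W"
    hence "(x, 0) \<in> cvs.span (B \<union> C)" "(0, y) \<in> cvs.span (B \<union> C)"
      using BC(2,4) cvs.span_mono[of B "B \<union> C"] cvs.span_mono[of C "B \<union> C"] by blast+
    from cvs.span_add[OF this] show "(x, y) \<in> cvs.span (B \<union> C)"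
      by simp
  qed
  thus "cdim (V \<times> W) < \<infinity>"
    using BC(1,3) unfolding cdim_finite_iff by blast
qed

lemma finite_eigenvalues_iff:
  "\<mu> \<in> finite_eigenvalues T \<longleftrightarrow> eigenvalue T \<mu> \<and> nullity (shift T \<mu>) < \<infinity>"
proof -
  have "0 < nullity (shift T \<mu>) \<longleftrightarrow> eigenvalue T \<mu>"
    unfolding nullity_def cdim_pos_iff by (auto simp: kernel_def eigenvalue_def shift_def)
  thus ?thesis
    by (simp add: finite_eigenvalues_def)
qed

lemma eigenvalue_op_sum:
  assumes "bounded_clinear S" and "bounded_clinear T"
  shows "eigenvalue (S \<oplus>\<^sub>o\<^sub>p T) \<mu> \<longleftrightarrow> eigenvalue S \<mu> \<or> eigenvalue T \<mu>"
proof -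
  have "S 0 = 0" "T 0 = 0"
    using assms unfolding bounded_clinear_def by (simp_all add: linear_simps)
  hence zero: "S 0 = \<mu> *\<^sub>C 0" "T 0 = \<mu> *\<^sub>C 0"
    by simp_all
  have "eigenvalue (S \<oplus>\<^sub>o\<^sub>p T) \<mu> \<longleftrightarrow>
      (\<exists>x y. (x \<noteq> 0 \<or> y \<noteq> 0) \<and> S x = \<mu> *\<^sub>C x \<and> T y = \<mu> *\<^sub>C y)"
    unfolding eigenvalue_def op_sum_def by (auto simp: scaleC_prod_def zero_prod_def)
  also have "\<dots> \<longleftrightarrow> eigenvalue S \<mu> \<or> eigenvalue T \<mu>"
    unfolding eigenvalue_def using zero by metis
  finally show ?thesis .
qed

lemma nullity_op_sum_finite_iff:
  assumes "bounded_clinear S" and "bounded_clinear T"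
  shows "nullity (shift (S \<oplus>\<^sub>o\<^sub>p T) \<mu>) < \<infinity> \<longleftrightarrow>
    nullity (shift S \<mu>) < \<infinity> \<and> nullity (shift T \<mu>) < \<infinity>"
proof -
  have "kernel (shift (S \<oplus>\<^sub>o\<^sub>p T) \<mu>) = kernel (shift S \<mu>) \<times> kernel (shift T \<mu>)"
    by (auto simp: kernel_def shift_op_sum zero_prod_def)
  moreover have "0 \<in> kernel (shift S \<mu>)" "0 \<in> kernel (shift T \<mu>)"
    using assms[THEN bounded_linear_shift] by (simp_all add: kernel_def linear_simps)
  ultimately show ?thesis
    unfolding nullity_def by (simp only: cdim_Times_finite_iff)
qed

section \<open>Property \<open>(z)\<close> for a direct sum\<close>

text \<open>Closedness keeps a point outside one of the sets from being one of its limit points.\<close>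

lemma iso_Un_closed:
  assumes "closed A" and "closed B"
  shows "\<mu> \<in> iso (A \<union> B) \<longleftrightarrow>
    \<mu> \<in> A \<union> B \<and> (\<mu> \<in> A \<longrightarrow> \<mu> \<in> iso A) \<and> (\<mu> \<in> B \<longrightarrow> \<mu> \<in> iso B)"
  using assms by (auto simp: iso_def isolated_in_islimpt_iff islimpt_Un closed_limpt)

text \<open>
  For a point isolated in \<open>\<sigma>\<^sub>a(S) \<union> \<sigma>\<^sub>a(T)\<close>, each summand either is bounded below there, or has
  there an isolated point of its own approximate point spectrum, hence an eigenvalue. In both
  cases the point avoids the upper semi-Weyl spectrum of the summand, in the second case by
  property \<open>(z)\<close>. Conversely, property \<open>(z)\<close> for a summand makes each point of its spectrum
  outside its upper semi-Weyl spectrum an isolated eigenvalue of finite multiplicity.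
\<close>

lemma pi00a_op_sum:
  fixes S :: "'a::cbanach \<Rightarrow> 'a" and T :: "'b::cbanach \<Rightarrow> 'b"
  assumes S: "bounded_clinear S" and T: "bounded_clinear T"
    and zS: "property_z S" and zT: "property_z T"
    and iS: "a_isoloid S" and iT: "a_isoloid T"
  shows "pi00a (S \<oplus>\<^sub>o\<^sub>p T) =
    spectrum (S \<oplus>\<^sub>o\<^sub>p T) - (upper_semi_Weyl_spectrum S \<union> upper_semi_Weyl_spectrum T)"
proof -
  \<comment> \<open>The right-hand sides for \<open>S\<close> and \<open>T\<close> together say that \<open>\<mu>\<close> is isolated in the union or
      outside it, with finite multiplicity for the direct sum.\<close>
  have summand: "\<mu> \<notin> upper_semi_Weyl_spectrum U \<longleftrightarrow>
      (\<mu> \<in> approx_point_spectrum U \<longrightarrow> \<mu> \<in> iso (approx_point_spectrum U)) \<and>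
      nullity (shift U \<mu>) < \<infinity>"
    if U: "bounded_clinear U" "property_z U" "a_isoloid U" for U :: "'c::cbanach \<Rightarrow> 'c" and \<mu>
  proof (cases "\<mu> \<in> approx_point_spectrum U")
    case True
    hence "\<mu> \<notin> upper_semi_Weyl_spectrum U \<longleftrightarrow> \<mu> \<in> pi00a U"
      using U(2) property_z_spectrum_eq[OF U(1,2)] unfolding property_z_def by blast
    thus ?thesis
      using True U(3) unfolding pi00a_def a_isoloid_def by (auto simp: finite_eigenvalues_iff)
  next
    case False
    hence "\<mu> \<notin> upper_semi_Weyl_spectrum U"
      using upper_semi_Weyl_spectrum_subset_approx_point_spectrum[OF U(1)] by blast
    thus ?thesis
      using False by (auto simp: upper_semi_Weyl_spectrum_def upper_semi_Weyl_def
          upper_semi_Fredholm_def)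
  qed
  have eig: "eigenvalue S \<mu> \<or> eigenvalue T \<mu>"
    if "\<mu> \<in> iso (approx_point_spectrum S \<union> approx_point_spectrum T)" for \<mu>
    using that iS iT closed_approx_point_spectrum[OF S] closed_approx_point_spectrum[OF T]
    unfolding a_isoloid_def by (auto simp: iso_Un_closed)
  show ?thesis
  proof (rule set_eqI)
    fix \<mu>
    have "\<mu> \<in> pi00a (S \<oplus>\<^sub>o\<^sub>p T) \<longleftrightarrow> \<mu> \<in> iso (approx_point_spectrum S \<union> approx_point_spectrum T) \<and>
        (eigenvalue S \<mu> \<or> eigenvalue T \<mu>) \<and> nullity (shift S \<mu>) < \<infinity> \<and> nullity (shift T \<mu>) < \<infinity>"
      by (simp only: pi00a_def Int_iff finite_eigenvalues_iff approx_point_spectrum_op_sum[OF S T]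
          eigenvalue_op_sum[OF S T] nullity_op_sum_finite_iff[OF S T])
    also have "\<dots> \<longleftrightarrow> \<mu> \<in> approx_point_spectrum S \<union> approx_point_spectrum T \<and>
        \<mu> \<notin> upper_semi_Weyl_spectrum S \<and> \<mu> \<notin> upper_semi_Weyl_spectrum T"
      using summand[OF S zS iS, of \<mu>] summand[OF T zT iT, of \<mu>] eig[of \<mu>]
        iso_Un_closed[OF closed_approx_point_spectrum[OF S] closed_approx_point_spectrum[OF T], of \<mu>]
      by argo
    also have "\<dots> \<longleftrightarrow> \<mu> \<in> spectrum (S \<oplus>\<^sub>o\<^sub>p T) -
        (upper_semi_Weyl_spectrum S \<union> upper_semi_Weyl_spectrum T)"
      unfolding spectrum_op_sum[OF S T] property_z_spectrum_eq[OF S zS]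
        property_z_spectrum_eq[OF T zT] by blast
    finally show "\<mu> \<in> pi00a (S \<oplus>\<^sub>o\<^sub>p T) \<longleftrightarrow> \<mu> \<in> spectrum (S \<oplus>\<^sub>o\<^sub>p T) -
        (upper_semi_Weyl_spectrum S \<union> upper_semi_Weyl_spectrum T)" .
  qed
qed

theorem theorem3p11:
  fixes S :: "'a::cbanach \<Rightarrow> 'a" and T :: "'b::cbanach \<Rightarrow> 'b"
  assumes "cdim (UNIV :: 'a set) = \<infinity>" and "cdim (UNIV :: 'b set) = \<infinity>"
    and "bounded_clinear S" and "bounded_clinear T"
    and "property_z S" and "property_z T"
    and "a_isoloid S" and "a_isoloid T"
  shows "property_z (S \<oplus>\<^sub>o\<^sub>p T) \<longleftrightarrow>
    upper_semi_Weyl_spectrum (S \<oplus>\<^sub>o\<^sub>p T) =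
      upper_semi_Weyl_spectrum S \<union> upper_semi_Weyl_spectrum T"
proof -
  have uw: "upper_semi_Weyl_spectrum U \<subseteq> spectrum U" if "bounded_clinear U"
    for U :: "'c::cbanach \<Rightarrow> 'c"
    using upper_semi_Weyl_spectrum_subset_approx_point_spectrum[OF that]
      approx_point_spectrum_subset_spectrum[OF that] by blast
  have "upper_semi_Weyl_spectrum S \<union> upper_semi_Weyl_spectrum T \<subseteq> spectrum (S \<oplus>\<^sub>o\<^sub>p T)"
    using uw[OF assms(3)] uw[OF assms(4)] spectrum_op_sum[OF assms(3,4)] by blast
  moreover have "upper_semi_Weyl_spectrum (S \<oplus>\<^sub>o\<^sub>p T) \<subseteq> spectrum (S \<oplus>\<^sub>o\<^sub>p T)"
    using uw[OF bounded_clinear_op_sum[OF assms(3,4)]] .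
  ultimately show ?thesis
    unfolding property_z_def pi00a_op_sum[OF assms(3-8)] by blast
qed

end
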